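(* Let $A\in\mathbb{R}^{n\times m}$ have rank $r$ and thin SVD $A=U\Sigma V^\top$, and let $u_i,v_j\in\mathbb{R}^r$ be the $i$th row of $U$ and the $j$th row of $V$. Suppose $A_{\widehat i,\widehat j}\ne0$ and let $$E^{(\widehat i,\widehat j)}=A-A(:,\widehat j)\,A_{\widehat i,\widehat j}^{-1}\,A(\widehat i,:).$$ Then, for every $\ell\in\{1,\ldots,n\}$ and $p\in\{1,\ldots,m\}$ for which the weighted angles below are defined, $$\left|E^{(\widehat i,\widehat j)}_{\ell p}\right|\le\frac{\|u_\ell\|_\sigma\|v_p\|_\sigma\left|\sin\angle_\sigma(u_\ell,u_{\widehat i})\,\sin\angle_\sigma(v_p,v_{\widehat j})\right|}{\left|\cos\angle_\sigma(u_{\widehat i},v_{\widehat j})\right|}.$$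
   Context: Thin SVD: $U\in\mathbb{R}^{n\times r}$, $V\in\mathbb{R}^{m\times r}$ have orthonormal columns, $\Sigma=\operatorname{diag}(\sigma_1,\ldots,\sigma_r)$ with $\sigma_1\ge\cdots\ge\sigma_r>0$. For $x,y\in\mathbb{R}^r$, $\langle x,y\rangle_\sigma=x^\top\Sigma y$ and $\|x\|_\sigma=\sqrt{\langle x,x\rangle_\sigma}$. When $\|x\|_\sigma,\|y\|_\sigma\neq0$, the weighted angle $\angle_\sigma(x,y)\in[0,\pi]$ is defined by $\cos\angle_\sigma(x,y)=\langle x,y\rangle_\sigma/(\|x\|_\sigma\|y\|_\sigma)$. $A(:,\widehat j)$ and $A(\widehat i,:)$ are the $\widehat j$th column and the $\widehat i$th row of $A$. *)

theory Defs
  imports "HOL-Analysis.Analysis"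
begin

definition diag_matrix :: "real ^ 'r \<Rightarrow> real ^ 'r ^ 'r" where
  "diag_matrix d = (\<chi> i j. if i = j then d $ i else 0)"

text \<open>The finite linear order on \<^typ>\<open>'r\<close> plays the role of the usual order on the indices
  \<open>1, \<dots>, r\<close> of the singular values, with \<open>r = CARD('r)\<close>.\<close>

definition thin_svd ::
  "real ^ 'm ^ 'n \<Rightarrow> real ^ ('r::{finite,linorder}) ^ 'n \<Rightarrow> real ^ ('r::{finite,linorder})
     \<Rightarrow> real ^ ('r::{finite,linorder}) ^ 'm \<Rightarrow> bool" where
  "thin_svd A U \<sigma> V \<longleftrightarrow>
     transpose U ** U = mat 1 \<and>
     transpose V ** V = mat 1 \<and>
     (\<forall>i j. i \<le> j \<longrightarrow> \<sigma> $ j \<le> \<sigma> $ i) \<and>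
     (\<forall>i. 0 < \<sigma> $ i) \<and>
     A = U ** diag_matrix \<sigma> ** transpose V"

definition weighted_inner :: "real ^ 'r \<Rightarrow> real ^ 'r \<Rightarrow> real ^ 'r \<Rightarrow> real" where
  "weighted_inner \<sigma> x y = x \<bullet> (diag_matrix \<sigma> *v y)"

definition weighted_norm :: "real ^ 'r \<Rightarrow> real ^ 'r \<Rightarrow> real" where
  "weighted_norm \<sigma> x = sqrt (weighted_inner \<sigma> x x)"

text \<open>\<^const>\<open>arccos\<close> selects the unique angle in \<open>[0, \<pi>]\<close> with the given cosine. The weighted angle is
  meaningful only when both weighted norms are nonzero.\<close>

definition weighted_angle :: "real ^ 'r \<Rightarrow> real ^ 'r \<Rightarrow> real ^ 'r \<Rightarrow> real" where
  "weighted_angle \<sigma> x y = arccos (weighted_inner \<sigma> x y / (weighted_norm \<sigma> x * weighted_norm \<sigma> y))"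

definition cross_residual :: "real ^ 'm ^ 'n \<Rightarrow> 'n \<Rightarrow> 'm \<Rightarrow> real ^ 'm ^ 'n" where
  "cross_residual A i j =
     A - (columnvector (column j A) :: real ^ 1 ^ 'n) ** mat (inverse (A $ i $ j)) ** rowvector (row i A)"

end

theory Submission
  imports Defs
begin

text \<open>
  Scaling the coordinates by \<open>\<surd>\<sigma>\<close> turns the weighted inner product into the Euclidean one. Writing
  \<open>a, b, c, d\<close> for the scaled rows \<open>u\<^sub>l\<close>, \<open>u\<^sub>i\<close>, \<open>v\<^sub>p\<close>, \<open>v\<^sub>j\<close>, where \<open>(i, j)\<close> is the pivot position, the
  decomposition \<open>A = U \<Sigma> V\<^sup>T\<close> says that every entry of \<open>A\<close> is an inner product, and the residual entry is
  \<open>a \<bullet> c - (a \<bullet> d) (b \<bullet> c) / (b \<bullet> d)\<close>.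

  This expression is bilinear in \<open>a\<close> and \<open>c\<close> and vanishes for \<open>a = b\<close> and for \<open>c = d\<close>. Hence \<open>a\<close> may be
  replaced by its component \<open>a'\<close> orthogonal to \<open>b\<close>, and \<open>c\<close> by its component \<open>c'\<close> orthogonal to \<open>d\<close>; their
  norms are \<open>\<parallel>a\<parallel> sin \<angle>(a, b)\<close> and \<open>\<parallel>c\<parallel> sin \<angle>(c, d)\<close>. What remains is \<open>a' \<bullet> T c'\<close> for the oblique
  projection \<open>T x = x - ((b \<bullet> x) / (b \<bullet> d)) d\<close>. Its norm is at most \<open>\<parallel>b\<parallel> \<parallel>d\<parallel> / \<bar>b \<bullet> d\<bar> = 1 / \<bar>cos \<angle>(b, d)\<bar>\<close>,
  which is needed here only on the orthogonal complement of \<open>d\<close> (lemma \<open>norm_oblique_projection_le\<close>), and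
  the Cauchy--Schwarz inequality finishes the proof.
\<close>

text \<open>The component of \<open>x\<close> orthogonal to \<open>y\<close>; it is \<open>x\<close> itself when \<open>y = 0\<close>.\<close>

definition orth_part :: "'a::real_inner \<Rightarrow> 'a \<Rightarrow> 'a" where
  "orth_part x y = x - ((x \<bullet> y) / (y \<bullet> y)) *\<^sub>R y"

lemma inner_orth_part [simp]: "orth_part x y \<bullet> y = 0"
  by (cases "y = 0") (simp_all add: orth_part_def inner_diff_left)

lemma norm_orth_part_power2:
  "(norm (orth_part x y))\<^sup>2 = x \<bullet> x - (x \<bullet> y)\<^sup>2 / (y \<bullet> y)"
proof -
  have "(norm (orth_part x y))\<^sup>2 = orth_part x y \<bullet> x"
    unfolding power2_norm_eq_inner
    by (subst (2) orth_part_def) (simp add: inner_diff_right)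
  also have "\<dots> = x \<bullet> x - (x \<bullet> y)\<^sup>2 / (y \<bullet> y)"
    by (simp add: orth_part_def inner_diff_left inner_commute[of y x] power2_eq_square)
  finally show ?thesis .
qed

lemma abs_cosine_le_1:
  fixes x y :: "'a::real_inner"
  shows "\<bar>(x \<bullet> y) / (norm x * norm y)\<bar> \<le> 1"
  using Cauchy_Schwarz_ineq2[of x y] by (auto simp: divide_le_eq_1 abs_mult)

lemma norm_orth_part:
  assumes "x \<noteq> 0" and "y \<noteq> 0"
  shows "norm (orth_part x y) = norm x * \<bar>sin (arccos ((x \<bullet> y) / (norm x * norm y)))\<bar>"
proof (rule power2_eq_imp_eq)
  let ?c = "(x \<bullet> y) / (norm x * norm y)"
  have "(sin (arccos ?c))\<^sup>2 = 1 - ?c\<^sup>2"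
    using abs_cosine_le_1[of x y] by (simp add: sin_squared_eq cos_arccos_abs)
  then show "(norm (orth_part x y))\<^sup>2 = (norm x * \<bar>sin (arccos ?c)\<bar>)\<^sup>2"
    using assms
    by (simp add: norm_orth_part_power2 power_mult_distrib power_divide right_diff_distrib
        flip: power2_norm_eq_inner)
qed simp_all

text \<open>The norm bound for the oblique projection along \<open>d\<close> onto the orthogonal complement of \<open>b\<close>, on
  vectors orthogonal to \<open>d\<close>.\<close>

lemma norm_oblique_projection_le:
  fixes b d x :: "'a::real_inner"
  assumes orth: "x \<bullet> d = 0" and bd: "b \<bullet> d \<noteq> 0"
  shows "norm (x - ((b \<bullet> x) / (b \<bullet> d)) *\<^sub>R d) \<le> norm x * (norm b * norm d / \<bar>b \<bullet> d\<bar>)"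
proof (rule power2_le_imp_le)
  have "d \<noteq> 0" using bd by auto
  then have dd: "d \<bullet> d > 0" by simp
  \<comment> \<open>As \<open>x\<close> is orthogonal to \<open>d\<close>, only the part of \<open>b\<close> orthogonal to \<open>d\<close> contributes to \<open>b \<bullet> x\<close>.\<close>
  have "b \<bullet> x = orth_part b d \<bullet> x"
    using orth by (simp add: orth_part_def inner_diff_left inner_commute[of d x])
  then have "(b \<bullet> x)\<^sup>2 \<le> (norm (orth_part b d))\<^sup>2 * (x \<bullet> x)"
    using Cauchy_Schwarz_ineq[of "orth_part b d" x] by (simp add: power2_norm_eq_inner)
  then have "(b \<bullet> x)\<^sup>2 * (d \<bullet> d) \<le> (b \<bullet> b - (b \<bullet> d)\<^sup>2 / (d \<bullet> d)) * (x \<bullet> x) * (d \<bullet> d)"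
    using dd by (simp add: norm_orth_part_power2)
  also have "\<dots> = (x \<bullet> x) * (b \<bullet> b) * (d \<bullet> d) - (x \<bullet> x) * (b \<bullet> d)\<^sup>2"
    using dd by (simp add: field_simps)
  finally have key: "(x \<bullet> x) * (b \<bullet> d)\<^sup>2 + (b \<bullet> x)\<^sup>2 * (d \<bullet> d) \<le> (x \<bullet> x) * (b \<bullet> b) * (d \<bullet> d)"
    by simp
  have "(norm (x - ((b \<bullet> x) / (b \<bullet> d)) *\<^sub>R d))\<^sup>2 = x \<bullet> x + ((b \<bullet> x) / (b \<bullet> d))\<^sup>2 * (d \<bullet> d)"
    using orth unfolding power2_norm_eq_inner
    by (simp add: inner_diff_left inner_diff_right inner_commute power2_eq_square)
  also have "\<dots> = ((x \<bullet> x) * (b \<bullet> d)\<^sup>2 + (b \<bullet> x)\<^sup>2 * (d \<bullet> d)) / (b \<bullet> d)\<^sup>2"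
    using bd by (simp add: field_simps)
  also have "\<dots> \<le> (x \<bullet> x) * (b \<bullet> b) * (d \<bullet> d) / (b \<bullet> d)\<^sup>2"
    by (rule divide_right_mono[OF key]) simp
  also have "\<dots> = (norm x * (norm b * norm d / \<bar>b \<bullet> d\<bar>))\<^sup>2"
    by (simp add: power_mult_distrib power_divide flip: power2_norm_eq_inner)
  finally show "(norm (x - ((b \<bullet> x) / (b \<bullet> d)) *\<^sub>R d))\<^sup>2
      \<le> (norm x * (norm b * norm d / \<bar>b \<bullet> d\<bar>))\<^sup>2" .
qed simp

text \<open>The Euclidean form of the bound.\<close>

lemma abs_bilinear_residual_le:
  fixes a b c d :: "'a::real_inner"
  assumes bd: "b \<bullet> d \<noteq> 0"
  shows "\<bar>a \<bullet> c - (a \<bullet> d) * (b \<bullet> c) / (b \<bullet> d)\<bar>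
    \<le> norm (orth_part a b) * norm (orth_part c d) * (norm b * norm d / \<bar>b \<bullet> d\<bar>)"
proof -
  let ?a = "orth_part a b" and ?c = "orth_part c d"
  let ?T = "\<lambda>x. x - ((b \<bullet> x) / (b \<bullet> d)) *\<^sub>R d"
  have T: "a \<bullet> c - (a \<bullet> d) * (b \<bullet> c) / (b \<bullet> d) = a \<bullet> ?T c"
    by (simp add: inner_diff_right)
  have "?T c = ?T ?c"
    using bd by (simp add: orth_part_def inner_diff_right diff_divide_distrib scaleR_diff_left)
  moreover have "b \<bullet> ?T ?c = 0"
    using bd by (simp add: inner_diff_right)
  ultimately have "a \<bullet> ?T c = ?a \<bullet> ?T ?c"
    unfolding orth_part_def[of a b] by (simp only: inner_diff_left inner_scaleR_left mult_zero_right diff_zero)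
  then have "\<bar>a \<bullet> c - (a \<bullet> d) * (b \<bullet> c) / (b \<bullet> d)\<bar> \<le> norm ?a * norm (?T ?c)"
    unfolding T by (simp only: Cauchy_Schwarz_ineq2)
  also have "\<dots> \<le> norm ?a * (norm ?c * (norm b * norm d / \<bar>b \<bullet> d\<bar>))"
    by (intro mult_left_mono norm_oblique_projection_le bd) simp_all
  finally show ?thesis by (simp add: mult.assoc)
qed

text \<open>Multiplication by the square root of the diagonal weight matrix.\<close>

definition sqrt_scale :: "real ^ 'r \<Rightarrow> real ^ 'r \<Rightarrow> real ^ 'r" where
  "sqrt_scale \<sigma> x = (\<chi> k. sqrt (\<sigma> $ k) * x $ k)"

lemma diag_matrix_mult_vec: "(diag_matrix \<sigma> *v x) $ k = \<sigma> $ k * x $ k"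
  by (simp add: diag_matrix_def matrix_vector_mult_def if_distrib[of "\<lambda>z. z * _"] cong: if_cong)

lemma weighted_inner_eq_inner:
  assumes "\<forall>k. 0 < \<sigma> $ k"
  shows "weighted_inner \<sigma> x y = sqrt_scale \<sigma> x \<bullet> sqrt_scale \<sigma> y"
proof -
  have "x $ k * (\<sigma> $ k * y $ k) = (sqrt (\<sigma> $ k) * x $ k) * (sqrt (\<sigma> $ k) * y $ k)" for k
  proof -
    have "\<sigma> $ k = sqrt (\<sigma> $ k) * sqrt (\<sigma> $ k)"
      using assms by (simp add: less_imp_le)
    then show ?thesis by (metis mult.assoc mult.left_commute)
  qed
  then show ?thesis
    unfolding weighted_inner_def inner_vec_def sqrt_scale_def
    by (simp only: diag_matrix_mult_vec inner_real_def vec_lambda_beta)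
qed

lemma weighted_norm_eq_norm:
  assumes "\<forall>k. 0 < \<sigma> $ k"
  shows "weighted_norm \<sigma> x = norm (sqrt_scale \<sigma> x)"
  using assms by (simp add: weighted_norm_def weighted_inner_eq_inner norm_eq_sqrt_inner)

lemma diag_product_nth:
  "(U ** diag_matrix \<sigma> ** transpose V) $ l $ p = weighted_inner \<sigma> (row l U) (row p V)"
proof -
  have "(U ** diag_matrix \<sigma> ** transpose V) $ l $ p
      = (\<Sum>k\<in>UNIV. U $ l $ k * (diag_matrix \<sigma> ** transpose V) $ k $ p)"
    unfolding matrix_mul_assoc[symmetric] by (subst matrix_matrix_mult_def) simp
  also have "\<dots> = (\<Sum>k\<in>UNIV. U $ l $ k * (diag_matrix \<sigma> *v row p V) $ k)"
    by (simp add: matrix_matrix_mult_def matrix_vector_mult_def transpose_def row_def)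
  finally show ?thesis
    by (simp add: weighted_inner_def inner_vec_def row_def)
qed

lemma cross_residual_nth:
  "cross_residual A i j $ l $ p = A $ l $ p - A $ l $ j * A $ i $ p / A $ i $ j"
  by (simp add: cross_residual_def matrix_matrix_mult_def columnvector_def rowvector_def
      mat_def column_def row_def divide_inverse)

theorem theorem2p12:
  fixes A :: "real ^ 'm ^ 'n"
    and U :: "real ^ ('r::{finite,linorder}) ^ 'n"
    and \<sigma> :: "real ^ ('r::{finite,linorder})"
    and V :: "real ^ ('r::{finite,linorder}) ^ 'm"
    and ih :: 'n and jh :: 'm
  assumes rank: "rank A = CARD('r)"
    and svd: "thin_svd A U \<sigma> V"
    and pivot: "A $ ih $ jh \<noteq> 0"
  shows "\<forall>l p.
     weighted_norm \<sigma> (row l U) \<noteq> 0 \<longrightarrow> weighted_norm \<sigma> (row ih U) \<noteq> 0 \<longrightarrow>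
     weighted_norm \<sigma> (row p V) \<noteq> 0 \<longrightarrow> weighted_norm \<sigma> (row jh V) \<noteq> 0 \<longrightarrow>
     \<bar>cross_residual A ih jh $ l $ p\<bar>
       \<le> weighted_norm \<sigma> (row l U) * weighted_norm \<sigma> (row p V)
           * \<bar>sin (weighted_angle \<sigma> (row l U) (row ih U)) * sin (weighted_angle \<sigma> (row p V) (row jh V))\<bar>
         / \<bar>cos (weighted_angle \<sigma> (row ih U) (row jh V))\<bar>"
proof (intro allI impI)
  fix l p
  assume nz: "weighted_norm \<sigma> (row l U) \<noteq> 0" "weighted_norm \<sigma> (row ih U) \<noteq> 0"
    "weighted_norm \<sigma> (row p V) \<noteq> 0" "weighted_norm \<sigma> (row jh V) \<noteq> 0"
  have pos: "\<forall>k. 0 < \<sigma> $ k" and A: "A = U ** diag_matrix \<sigma> ** transpose V"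
    using svd by (simp_all add: thin_svd_def)
  note to_euclidean = weighted_inner_eq_inner[OF pos] weighted_norm_eq_norm[OF pos]
  define a where "a = sqrt_scale \<sigma> (row l U)"
  define b where "b = sqrt_scale \<sigma> (row ih U)"
  define c where "c = sqrt_scale \<sigma> (row p V)"
  define d where "d = sqrt_scale \<sigma> (row jh V)"
  note abcd = a_def[symmetric] b_def[symmetric] c_def[symmetric] d_def[symmetric]
  have nz': "a \<noteq> 0" "b \<noteq> 0" "c \<noteq> 0" "d \<noteq> 0"
    using nz by (auto simp: to_euclidean abcd)
  have bd: "b \<bullet> d \<noteq> 0"
    using pivot by (simp add: A diag_product_nth to_euclidean abcd)
  have res: "cross_residual A ih jh $ l $ p = a \<bullet> c - (a \<bullet> d) * (b \<bullet> c) / (b \<bullet> d)"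
    by (simp add: cross_residual_nth A diag_product_nth to_euclidean abcd)
  have cos_bd: "\<bar>cos (arccos ((b \<bullet> d) / (norm b * norm d)))\<bar> = \<bar>b \<bullet> d\<bar> / (norm b * norm d)"
    using abs_cosine_le_1[of b d] by (simp add: cos_arccos_abs abs_mult)
  show "\<bar>cross_residual A ih jh $ l $ p\<bar>
       \<le> weighted_norm \<sigma> (row l U) * weighted_norm \<sigma> (row p V)
           * \<bar>sin (weighted_angle \<sigma> (row l U) (row ih U)) * sin (weighted_angle \<sigma> (row p V) (row jh V))\<bar>
         / \<bar>cos (weighted_angle \<sigma> (row ih U) (row jh V))\<bar>"
    using abs_bilinear_residual_le[OF bd, of a c]
    unfolding res weighted_angle_def to_euclidean abcd cos_bd
      norm_orth_part[OF nz'(1,2)] norm_orth_part[OF nz'(3,4)]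
    by (simp add: abs_mult mult_ac)
qed

end
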